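(* Let $(A,\succ_A,\prec_A)$ be an anti-dendriform algebra. Assume that there is an anti-dendriform algebra structure $(\succ_{A^*},\prec_{A^*})$ on the dual space $A^*$. Let $(A,\cdot)$ and $(A^*,\ast)$ be the associated associative algebras of $(A,\succ_A,\prec_A)$ and $(A^*,\succ_{A^*},\prec_{A^*})$ respectively. Suppose that $\Delta_{\succ},\Delta_{\prec}:A\to A\otimes A$ and $\delta_{\succ},\delta_{\prec}:A^*\to A^*\otimes A^*$ are the duals of $\succ_{A^*},\prec_{A^*}$ and $\succ_A,\prec_A$ respectively. Then the following conditions are equivalent: (a) $(A,\succ_A,\prec_A,\Delta_{\succ},\Delta_{\prec})$ is an anti-dendriform D-bialgebra. (b) For all $x,y\in A$ and $a,b\in A^*$ the following equations hold: $$\Delta_{\prec}(x\cdot y)=(R_{\cdot}(y)\otimes I)\Delta_{\prec}(x)-(I\otimes L_{\succ_A}(x))\Delta_{\prec}(y),$$ $$\Delta_{\succ}(x\cdot y)=(I\otimes L_{\cdot}(x))\Delta_{\succ}(y)-(R_{\prec_A}(y)\otimes I)\Delta_{\succ}(x),$$ $$(I\otimes R_{\cdot}(y))\Delta_{\succ}(x)+(L_{\succ_A}(y)\otimes I)\Delta_{\succ}(x)-\tau(I\otimes R_{\prec_A}(x))\Delta_{\prec}(y)-\tau(L_{\cdot}(x)\otimes I)\Delta_{\prec}(y)=0,$$ $$\delta_{\prec}(a\ast b)=(R_{\ast}(b)\otimes I)\delta_{\prec}(a)-(I\otimes L_{\succ_{A^*}}(a))\delta_{\prec}(b),$$ $$\delta_{\succ}(a\ast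 b)=(I\otimes L_{\ast}(a))\delta_{\succ}(b)-(R_{\prec_{A^*}}(b)\otimes I)\delta_{\succ}(a),$$ $$(I\otimes R_{\ast}(b))\delta_{\succ}(a)+(L_{\succ_{A^*}}(b)\otimes I)\delta_{\succ}(a)-\tau(I\otimes R_{\prec_{A^*}}(a))\delta_{\prec}(b)-\tau(L_{\ast}(a)\otimes I)\delta_{\prec}(b)=0.$$ (c) $(A,A^*,-R_{\prec_A}^*,-L_{\succ_A}^*,-R_{\prec_{A^*}}^*,-L_{\succ_{A^*}}^* )$ is a matched pair of associative algebras.
   Context: All vector spaces and algebras are over a field $k$, and all algebras are finite-dimensional. An anti-dendriform algebra $(A,\succ,\prec)$ is a vector space with two bilinear maps $\succ,\prec:A\times A\to A$ such that, writing $x\cdot y=x\succ y+x\prec y$, for all $x,y,z$: $x\succ(y\succ z)=-(x\cdot y)\succ z=-x\prec(y\cdot z)=(x\prec y)\prec z$ and $(x\succ y)\prec z=x\succ(y\prec z)$. Then $(A,\cdot)$ is associative, called the associated associative algebra. $L_{\succ}(x)y=R_{\succ}(y)x=x\succ y$, $L_{\prec}(x)y=R_{\prec}(y)x=x\prec y$, $L_{\cdot}=L_{\succ}+L_{\prec}$, $R_{\cdot}=R_{\succ}+R_{\prec}$; for $A^*$ similarly with $L_{\ast}=L_{\succ_{A^*}}+L_{\prec_{A^*}}$, $R_{\ast}=R_{\succ_{A^*}}+R_{\prec_{A^*}}$. $I$ is the identity and $\tau(x\otimes y)=y\otimes x$. For a linear map $f:A\to\mathrm{End}(V)$, $f^*:A\to\mathrm{End}(V^*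 )$ is defined by $\langle f^*(x)u^*,v\rangle=\langle u^*,f(x)v\rangle$ (no sign); $A^{**}=A$. The duals are given by $\langle\Delta_{\succ}(x),a\otimes b\rangle=\langle x,a\succ_{A^*}b\rangle$, $\langle\Delta_{\prec}(x),a\otimes b\rangle=\langle x,a\prec_{A^*}b\rangle$, $\langle\delta_{\succ}(a),x\otimes y\rangle=\langle a,x\succ_A y\rangle$, $\langle\delta_{\prec}(a),x\otimes y\rangle=\langle a,x\prec_A y\rangle$. An anti-dendriform coalgebra is $(A,\Delta_{\succ},\Delta_{\prec})$ with linear maps $\Delta_{\succ},\Delta_{\prec}:A\to A\otimes A$ such that, with $\Delta=\Delta_{\succ}+\Delta_{\prec}$, $(\Delta_{\succ}\otimes I)\Delta_{\prec}=(I\otimes\Delta_{\prec})\Delta_{\succ}$ and $(I\otimes\Delta_{\succ})\Delta_{\succ}=-(\Delta\otimes I)\Delta_{\succ}=(\Delta_{\prec}\otimes I)\Delta_{\prec}=-(I\otimes\Delta)\Delta_{\prec}$. An anti-dendriform D-bialgebra is $(A,\succ,\prec,\Delta_{\succ},\Delta_{\prec})$ such that $(A,\succ,\prec)$ is an anti-dendriform algebra, $(A,\Delta_{\succ},\Delta_{\prec})$ is an anti-dendriform coalgebra, and for all $x,y\in A$: $\Delta_{\prec}(x\cdot y)=(R_{\cdot}(y)\otimes I)\Delta_{\prec}(x)-(I\otimes L_{\succ}(x))\Delta_{\prec}(y)$; $\Delta_{\succ}(x\cdot y)=(I\otimes L_{\cdot}(x))\Delta_{\succ}(y)-(R_{\prec}(y)\otimes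 I)\Delta_{\succ}(x)$; $(I\otimes R_{\cdot}(y))\Delta_{\succ}(x)+(L_{\succ}(y)\otimes I)\Delta_{\succ}(x)-\tau(I\otimes R_{\prec}(x))\Delta_{\prec}(y)-\tau(L_{\cdot}(x)\otimes I)\Delta_{\prec}(y)=0$; $\Delta(x\prec y)=(R_{\prec}(y)\otimes I)\Delta(x)-(I\otimes L_{\prec}(x))\Delta_{\succ}(y)$; $\Delta(x\succ y)=(I\otimes L_{\succ}(x))\Delta(y)-(R_{\succ}(y)\otimes I)\Delta_{\prec}(x)$; $(L_{\succ}(x)\otimes I)\Delta(y)+(R_{\succ}(y)\otimes I)\tau\Delta_{\succ}(x)-(I\otimes L_{\prec}(y))\tau\Delta_{\prec}(x)-(I\otimes R_{\prec}(x))\Delta(y)=0$. Matched pair of associative algebras: for associative algebras $(A_1,\circ_1)$, $(A_2,\circ_2)$ and linear maps $l_1,r_1:A_1\to\mathrm{End}(A_2)$, $l_2,r_2:A_2\to\mathrm{End}(A_1)$, $(A_1,A_2,l_1,r_1,l_2,r_2)$ is a matched pair if $(A_2,l_1,r_1)$ is a bimodule of $A_1$, $(A_1,l_2,r_2)$ is a bimodule of $A_2$ (bimodule $(V,l,r)$ of $(A,\cdot)$: $l(x\cdot y)=l(x)l(y)$, $r(x\cdot y)=r(y)r(x)$, $l(x)r(y)=r(y)l(x)$), and for all $x,y\in A_1$, $a,b\in A_2$: $l_1(x)(a\circ_2 b)=l_1(r_2(a)x)b+(l_1(x)a)\circ_2 b$; $r_1(x)(a\circ_2 b)=r_1(l_2(b)x)a+a\circ_2(r_1(x)b)$;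 $l_2(a)(x\circ_1 y)=l_2(r_1(x)a)y+(l_2(a)x)\circ_1 y$; $r_2(a)(x\circ_1 y)=r_2(l_1(y)a)x+x\circ_1(r_2(a)y)$; $l_1(l_2(a)x)b+(r_1(x)a)\circ_2 b-r_1(r_2(b)x)a-a\circ_2(l_1(x)b)=0$; $l_2(l_1(x)a)y+(r_2(a)x)\circ_1 y-r_2(r_1(y)a)x-x\circ_1(l_2(a)y)=0$. *)

theory Defs
  imports "HOL.Vector_Spaces" "HOL-Library.Function_Algebras"
begin

section \<open>Finite-dimensional vector spaces, duals and tensor products\<close>

text \<open>
  A vector space is a subspace \<open>carr X\<close> of an ambient type, with an explicit scalar multiplication
  that makes the whole type a vector space.  Carriers are needed because the dual of a space
  is not a type of its own.
\<close>

record ('k, 'a) vspace =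
  carr :: "'a set"
  scl :: "'k \<Rightarrow> 'a \<Rightarrow> 'a"

definition fin_dim_space :: "('k::field, 'a::ab_group_add) vspace \<Rightarrow> bool" where
  "fin_dim_space X \<longleftrightarrow>
    vector_space (scl X) \<and> (\<exists>B. finite B \<and> carr X = module.span (scl X) B)"

definition linear_on ::
  "('k::field, 'a::ab_group_add) vspace \<Rightarrow> ('k, 'b::ab_group_add) vspace \<Rightarrow> ('a \<Rightarrow> 'b) \<Rightarrow> bool" where
  "linear_on X Y f \<longleftrightarrow>
    (\<forall>x\<in>carr X. f x \<in> carr Y) \<and>
    (\<forall>x\<in>carr X. \<forall>y\<in>carr X. f (x + y) = f x + f y) \<and>
    (\<forall>c. \<forall>x\<in>carr X. f (scl X c x) = scl Y c (f x))"

definition bilinear_on ::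
  "('k::field, 'a::ab_group_add) vspace \<Rightarrow> ('k, 'b::ab_group_add) vspace \<Rightarrow>
   ('k, 'c::ab_group_add) vspace \<Rightarrow> ('a \<Rightarrow> 'b \<Rightarrow> 'c) \<Rightarrow> bool" where
  "bilinear_on X Y Z f \<longleftrightarrow>
    (\<forall>x\<in>carr X. linear_on Y Z (f x)) \<and> (\<forall>y\<in>carr Y. linear_on X Z (\<lambda>x. f x y))"

definition ground :: "('k::field, 'k) vspace" where
  "ground = \<lparr>carr = UNIV, scl = (*)\<rparr>"

text \<open>Functionals are set to \<open>0\<close> off the carrier, so that equality in the dual is equality of functions.\<close>

definition dual :: "('k::field, 'a::ab_group_add) vspace \<Rightarrow> ('k, 'a \<Rightarrow> 'k) vspace" where
  "dual X = \<lparr>carr = {f. linear_on X ground f \<and> (\<forall>x. x \<notin> carr X \<longrightarrow> f x = 0)},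
             scl = (\<lambda>c f x. c * f x)\<rparr>"

definition dual_map ::
  "('k::field, 'a::ab_group_add) vspace \<Rightarrow> ('a \<Rightarrow> 'b) \<Rightarrow> ('b \<Rightarrow> 'k) \<Rightarrow> ('a \<Rightarrow> 'k)" where
  "dual_map X f u = (\<lambda>x. if x \<in> carr X then u (f x) else 0)"

definition ev :: "('k::field, 'a::ab_group_add) vspace \<Rightarrow> 'a \<Rightarrow> ('a \<Rightarrow> 'k) \<Rightarrow> 'k" where
  "ev X x = (\<lambda>f. if f \<in> carr (dual X) then f x else 0)"

text \<open>The transpose of an endomorphism \<open>g\<close> of the dual, as an endomorphism of \<open>X\<close> itself:
  the bidual is identified with \<open>X\<close> by \<open>ev X\<close>.\<close>

definition predual_map ::
  "('k::field, 'a::ab_group_add) vspace \<Rightarrow> (('a \<Rightarrow> 'k) \<Rightarrow> ('a \<Rightarrow> 'k)) \<Rightarrow> 'a \<Rightarrow> 'a" where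
  "predual_map X g x = the_inv_into (carr X) (ev X) (dual_map (dual X) g (ev X x))"

text \<open>
  The tensor product is modelled as the span of the elementary tensors
  \<open>(f, g) \<mapsto> f x * g y\<close> inside the functions on pairs of functionals; the usual
  universal property is proved below (\<open>tensor_universal\<close>).  Evaluating a tensor at \<open>(f, g)\<close>
  is its pairing with \<open>f \<otimes> g\<close>.
\<close>

definition tens ::
  "('k::field, 'a::ab_group_add) vspace \<Rightarrow> ('k, 'b::ab_group_add) vspace \<Rightarrow>
   'a \<Rightarrow> 'b \<Rightarrow> ('a \<Rightarrow> 'k) \<Rightarrow> ('b \<Rightarrow> 'k) \<Rightarrow> 'k" where
  "tens X Y x y = (\<lambda>f g. if f \<in> carr (dual X) \<and> g \<in> carr (dual Y) then f x * g y else 0)"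

definition tensor_space ::
  "('k::field, 'a::ab_group_add) vspace \<Rightarrow> ('k, 'b::ab_group_add) vspace \<Rightarrow>
   ('k, ('a \<Rightarrow> 'k) \<Rightarrow> ('b \<Rightarrow> 'k) \<Rightarrow> 'k) vspace" where
  "tensor_space X Y =
    \<lparr>carr = module.span (\<lambda>c t f g. c * t f g) {tens X Y x y | x y. x \<in> carr X \<and> y \<in> carr Y},
     scl = (\<lambda>c t f g. c * t f g)\<rparr>"

definition tensor_pairing ::
  "(('a \<Rightarrow> 'k) \<Rightarrow> ('b \<Rightarrow> 'k) \<Rightarrow> 'k) \<Rightarrow> ('a \<Rightarrow> 'k) \<Rightarrow> ('b \<Rightarrow> 'k) \<Rightarrow> 'k" where
  "tensor_pairing t f g = t f g"

text \<open>\<open>tensor_map X Y X' Y' f g\<close> is \<open>f \<otimes> g\<close> for \<open>f : X \<rightarrow> X'\<close> and \<open>g : Y \<rightarrow> Y'\<close>;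
  see \<open>tensor_map_tens\<close>.\<close>

definition tensor_map ::
  "('k::field, 'a::ab_group_add) vspace \<Rightarrow> ('k, 'b::ab_group_add) vspace \<Rightarrow>
   ('k, 'c::ab_group_add) vspace \<Rightarrow> ('k, 'd::ab_group_add) vspace \<Rightarrow>
   ('a \<Rightarrow> 'c) \<Rightarrow> ('b \<Rightarrow> 'd) \<Rightarrow>
   (('a \<Rightarrow> 'k) \<Rightarrow> ('b \<Rightarrow> 'k) \<Rightarrow> 'k) \<Rightarrow> (('c \<Rightarrow> 'k) \<Rightarrow> ('d \<Rightarrow> 'k) \<Rightarrow> 'k)" where
  "tensor_map X Y X' Y' f g t =
    (\<lambda>u v. if u \<in> carr (dual X') \<and> v \<in> carr (dual Y')
           then t (dual_map X f u) (dual_map Y g v) else 0)"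

abbreviation tmap ::
  "('k::field, 'a::ab_group_add) vspace \<Rightarrow> ('a \<Rightarrow> 'a) \<Rightarrow> ('a \<Rightarrow> 'a) \<Rightarrow>
   (('a \<Rightarrow> 'k) \<Rightarrow> ('a \<Rightarrow> 'k) \<Rightarrow> 'k) \<Rightarrow> (('a \<Rightarrow> 'k) \<Rightarrow> ('a \<Rightarrow> 'k) \<Rightarrow> 'k)" where
  "tmap X \<equiv> tensor_map X X X X"

definition swap :: "('u \<Rightarrow> 'v \<Rightarrow> 'k) \<Rightarrow> ('v \<Rightarrow> 'u \<Rightarrow> 'k)" where
  "swap t = (\<lambda>f g. t g f)"

text \<open>
  Both \<open>(X \<otimes> X) \<otimes> X\<close> and \<open>X \<otimes> (X \<otimes> X)\<close> are identified with \<open>X \<otimes> X \<otimes> X\<close>, realised by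
  functions of three functionals; \<open>(x \<otimes> y) \<otimes> z\<close> and \<open>x \<otimes> (y \<otimes> z)\<close> both go to \<open>tens3 X x y z\<close>.
\<close>

definition tens3 ::
  "('k::field, 'a::ab_group_add) vspace \<Rightarrow> 'a \<Rightarrow> 'a \<Rightarrow> 'a \<Rightarrow>
   ('a \<Rightarrow> 'k) \<Rightarrow> ('a \<Rightarrow> 'k) \<Rightarrow> ('a \<Rightarrow> 'k) \<Rightarrow> 'k" where
  "tens3 X x y z =
    (\<lambda>f g h. if f \<in> carr (dual X) \<and> g \<in> carr (dual X) \<and> h \<in> carr (dual X)
             then f x * g y * h z else 0)"

definition tens_functional ::
  "('k::field, 'a::ab_group_add) vspace \<Rightarrow> ('a \<Rightarrow> 'k) \<Rightarrow> ('a \<Rightarrow> 'k) \<Rightarrow>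
   (('a \<Rightarrow> 'k) \<Rightarrow> ('a \<Rightarrow> 'k) \<Rightarrow> 'k) \<Rightarrow> 'k" where
  "tens_functional X f g =
    (\<lambda>t. if t \<in> carr (tensor_space X X) then tensor_pairing t f g else 0)"

definition flatten_left ::
  "('k::field, 'a::ab_group_add) vspace \<Rightarrow>
   (((('a \<Rightarrow> 'k) \<Rightarrow> ('a \<Rightarrow> 'k) \<Rightarrow> 'k) \<Rightarrow> 'k) \<Rightarrow> ('a \<Rightarrow> 'k) \<Rightarrow> 'k) \<Rightarrow>
   ('a \<Rightarrow> 'k) \<Rightarrow> ('a \<Rightarrow> 'k) \<Rightarrow> ('a \<Rightarrow> 'k) \<Rightarrow> 'k" where
  "flatten_left X T = (\<lambda>f g h. T (tens_functional X f g) h)"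

definition flatten_right ::
  "('k::field, 'a::ab_group_add) vspace \<Rightarrow>
   (('a \<Rightarrow> 'k) \<Rightarrow> ((('a \<Rightarrow> 'k) \<Rightarrow> ('a \<Rightarrow> 'k) \<Rightarrow> 'k) \<Rightarrow> 'k) \<Rightarrow> 'k) \<Rightarrow>
   ('a \<Rightarrow> 'k) \<Rightarrow> ('a \<Rightarrow> 'k) \<Rightarrow> ('a \<Rightarrow> 'k) \<Rightarrow> 'k" where
  "flatten_right X T = (\<lambda>f g h. T f (tens_functional X g h))"

section \<open>Algebras, coalgebras and bialgebras\<close>

definition rmul :: "('a \<Rightarrow> 'b \<Rightarrow> 'c) \<Rightarrow> 'b \<Rightarrow> 'a \<Rightarrow> 'c" where
  "rmul m y = (\<lambda>x. m x y)"

definition lmul :: "('a \<Rightarrow> 'b \<Rightarrow> 'c) \<Rightarrow> 'a \<Rightarrow> 'b \<Rightarrow> 'c" where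
  "lmul m x = (\<lambda>y. m x y)"

definition add_op :: "('a \<Rightarrow> 'a \<Rightarrow> 'a::ab_group_add) \<Rightarrow> ('a \<Rightarrow> 'a \<Rightarrow> 'a) \<Rightarrow> 'a \<Rightarrow> 'a \<Rightarrow> 'a" where
  "add_op succ prec = (\<lambda>x y. succ x y + prec x y)"

definition associative_algebra ::
  "('k::field, 'a::ab_group_add) vspace \<Rightarrow> ('a \<Rightarrow> 'a \<Rightarrow> 'a) \<Rightarrow> bool" where
  "associative_algebra X m \<longleftrightarrow>
    fin_dim_space X \<and> bilinear_on X X X m \<and>
    (\<forall>x\<in>carr X. \<forall>y\<in>carr X. \<forall>z\<in>carr X. m (m x y) z = m x (m y z))"

definition anti_dendriform_algebra ::
  "('k::field, 'a::ab_group_add) vspace \<Rightarrow> ('a \<Rightarrow> 'a \<Rightarrow> 'a) \<Rightarrow> ('a \<Rightarrow> 'a \<Rightarrow> 'a) \<Rightarrow> bool" where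
  "anti_dendriform_algebra X succ prec \<longleftrightarrow>
    fin_dim_space X \<and> bilinear_on X X X succ \<and> bilinear_on X X X prec \<and>
    (\<forall>x\<in>carr X. \<forall>y\<in>carr X. \<forall>z\<in>carr X.
      succ x (succ y z) = - succ (add_op succ prec x y) z \<and>
      - succ (add_op succ prec x y) z = - prec x (add_op succ prec y z) \<and>
      - prec x (add_op succ prec y z) = prec (prec x y) z \<and>
      prec (succ x y) z = succ x (prec y z))"

definition anti_dendriform_coalgebra ::
  "('k::field, 'a::ab_group_add) vspace \<Rightarrow> ('a \<Rightarrow> ('a \<Rightarrow> 'k) \<Rightarrow> ('a \<Rightarrow> 'k) \<Rightarrow> 'k) \<Rightarrow>
   ('a \<Rightarrow> ('a \<Rightarrow> 'k) \<Rightarrow> ('a \<Rightarrow> 'k) \<Rightarrow> 'k) \<Rightarrow> bool" where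
  "anti_dendriform_coalgebra X Ds Dp \<longleftrightarrow>
    fin_dim_space X \<and> linear_on X (tensor_space X X) Ds \<and> linear_on X (tensor_space X X) Dp \<and>
    (let XX = tensor_space X X;
         D = (\<lambda>x. Ds x + Dp x);
         left = (\<lambda>E t. flatten_left X (tensor_map X X XX X E id t));
         right = (\<lambda>E t. flatten_right X (tensor_map X X X XX id E t))
     in \<forall>x\<in>carr X.
       left Ds (Dp x) = right Dp (Ds x) \<and>
       right Ds (Ds x) = - left D (Ds x) \<and>
       - left D (Ds x) = left Dp (Dp x) \<and>
       left Dp (Dp x) = - right D (Dp x))"

definition anti_dendriform_D_bialgebra ::
  "('k::field, 'a::ab_group_add) vspace \<Rightarrow> ('a \<Rightarrow> 'a \<Rightarrow> 'a) \<Rightarrow> ('a \<Rightarrow> 'a \<Rightarrow> 'a) \<Rightarrow>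
   ('a \<Rightarrow> ('a \<Rightarrow> 'k) \<Rightarrow> ('a \<Rightarrow> 'k) \<Rightarrow> 'k) \<Rightarrow>
   ('a \<Rightarrow> ('a \<Rightarrow> 'k) \<Rightarrow> ('a \<Rightarrow> 'k) \<Rightarrow> 'k) \<Rightarrow> bool" where
  "anti_dendriform_D_bialgebra X succ prec Ds Dp \<longleftrightarrow>
    anti_dendriform_algebra X succ prec \<and> anti_dendriform_coalgebra X Ds Dp \<and>
    (let dot = add_op succ prec; D = (\<lambda>x. Ds x + Dp x) in
     \<forall>x\<in>carr X. \<forall>y\<in>carr X.
       Dp (dot x y) = tmap X (rmul dot y) id (Dp x) - tmap X id (lmul succ x) (Dp y) \<and>
       Ds (dot x y) = tmap X id (lmul dot x) (Ds y) - tmap X (rmul prec y) id (Ds x) \<and>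
       tmap X id (rmul dot y) (Ds x) + tmap X (lmul succ y) id (Ds x)
         - swap (tmap X id (rmul prec x) (Dp y)) - swap (tmap X (lmul dot x) id (Dp y)) = 0 \<and>
       D (prec x y) = tmap X (rmul prec y) id (D x) - tmap X id (lmul prec x) (Ds y) \<and>
       D (succ x y) = tmap X id (lmul succ x) (D y) - tmap X (rmul succ y) id (Dp x) \<and>
       tmap X (lmul succ x) id (D y) + tmap X (rmul succ y) id (swap (Ds x))
         - tmap X id (lmul prec y) (swap (Dp x)) - tmap X id (rmul prec x) (D y) = 0)"

text \<open>\<open>D\<close> is the comultiplication on \<open>X\<close> dual to the product \<open>m\<close> on the dual of \<open>X\<close>.\<close>

definition comult_of_dual_product ::
  "('k::field, 'a::ab_group_add) vspace \<Rightarrow> (('a \<Rightarrow> 'k) \<Rightarrow> ('a \<Rightarrow> 'k) \<Rightarrow> ('a \<Rightarrow> 'k)) \<Rightarrow>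
   ('a \<Rightarrow> ('a \<Rightarrow> 'k) \<Rightarrow> ('a \<Rightarrow> 'k) \<Rightarrow> 'k) \<Rightarrow> bool" where
  "comult_of_dual_product X m D \<longleftrightarrow>
    linear_on X (tensor_space X X) D \<and>
    (\<forall>x\<in>carr X. \<forall>a\<in>carr (dual X). \<forall>b\<in>carr (dual X). tensor_pairing (D x) a b = m a b x)"

text \<open>\<open>\<delta>\<close> is the comultiplication on the dual of \<open>X\<close> dual to the product \<open>m\<close> on \<open>X\<close>.\<close>

definition dual_comult_of_product ::
  "('k::field, 'a::ab_group_add) vspace \<Rightarrow> ('a \<Rightarrow> 'a \<Rightarrow> 'a) \<Rightarrow>
   (('a \<Rightarrow> 'k) \<Rightarrow> (('a \<Rightarrow> 'k) \<Rightarrow> 'k) \<Rightarrow> (('a \<Rightarrow> 'k) \<Rightarrow> 'k) \<Rightarrow> 'k) \<Rightarrow> bool" where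
  "dual_comult_of_product X m \<delta> \<longleftrightarrow>
    linear_on (dual X) (tensor_space (dual X) (dual X)) \<delta> \<and>
    (\<forall>a\<in>carr (dual X). \<forall>x\<in>carr X. \<forall>y\<in>carr X.
      tensor_pairing (\<delta> a) (ev X x) (ev X y) = a (m x y))"

section \<open>Matched pairs of associative algebras\<close>

definition bimodule ::
  "('k::field, 'a::ab_group_add) vspace \<Rightarrow> ('a \<Rightarrow> 'a \<Rightarrow> 'a) \<Rightarrow> ('k, 'v::ab_group_add) vspace \<Rightarrow>
   ('a \<Rightarrow> 'v \<Rightarrow> 'v) \<Rightarrow> ('a \<Rightarrow> 'v \<Rightarrow> 'v) \<Rightarrow> bool" where
  "bimodule X m V l r \<longleftrightarrow>
    bilinear_on X V V l \<and> bilinear_on X V V r \<and>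
    (\<forall>x\<in>carr X. \<forall>y\<in>carr X. \<forall>v\<in>carr V.
      l (m x y) v = l x (l y v) \<and> r (m x y) v = r y (r x v) \<and> l x (r y v) = r y (l x v))"

definition matched_pair ::
  "('k::field, 'a::ab_group_add) vspace \<Rightarrow> ('a \<Rightarrow> 'a \<Rightarrow> 'a) \<Rightarrow>
   ('k, 'b::ab_group_add) vspace \<Rightarrow> ('b \<Rightarrow> 'b \<Rightarrow> 'b) \<Rightarrow>
   ('a \<Rightarrow> 'b \<Rightarrow> 'b) \<Rightarrow> ('a \<Rightarrow> 'b \<Rightarrow> 'b) \<Rightarrow> ('b \<Rightarrow> 'a \<Rightarrow> 'a) \<Rightarrow> ('b \<Rightarrow> 'a \<Rightarrow> 'a) \<Rightarrow> bool" where
  "matched_pair X m Y n l1 r1 l2 r2 \<longleftrightarrow>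
    associative_algebra X m \<and> associative_algebra Y n \<and>
    bimodule X m Y l1 r1 \<and> bimodule Y n X l2 r2 \<and>
    (\<forall>x\<in>carr X. \<forall>y\<in>carr X. \<forall>a\<in>carr Y. \<forall>b\<in>carr Y.
      l1 x (n a b) = l1 (r2 a x) b + n (l1 x a) b \<and>
      r1 x (n a b) = r1 (l2 b x) a + n a (r1 x b) \<and>
      l2 a (m x y) = l2 (r1 x a) y + m (l2 a x) y \<and>
      r2 a (m x y) = r2 (l1 y a) x + m x (r2 a y) \<and>
      l1 (l2 a x) b + n (r1 x a) b - r1 (r2 b x) a - n a (l1 x b) = 0 \<and>
      l2 (l1 x a) y + m (r2 a x) y - r2 (r1 y a) x - m x (l2 a y) = 0)"

section \<open>Adequacy of the encodings\<close>

lemma carr_dual_iff: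
  "f \<in> carr (dual X) \<longleftrightarrow> linear_on X ground f \<and> (\<forall>x. x \<notin> carr X \<longrightarrow> f x = 0)"
  by (simp add: dual_def)

lemma vector_space_tensor_scale: "vector_space (\<lambda>(c::'k::field) t f g. c * t f g)"
  by unfold_locales (auto simp: fun_eq_iff algebra_simps)

lemma tens_in_tensor_space:
  "x \<in> carr X \<Longrightarrow> y \<in> carr Y \<Longrightarrow> tens X Y x y \<in> carr (tensor_space X Y)"
  unfolding tensor_space_def
  by (auto intro!: module.span_base vector_space_tensor_scale[unfolded module_iff_vector_space[symmetric]])

lemma tensor_pairing_tens:
  "f \<in> carr (dual X) \<Longrightarrow> g \<in> carr (dual Y) \<Longrightarrow> tensor_pairing (tens X Y x y) f g = f x * g y"
  by (simp add: tensor_pairing_def tens_def)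

lemma dual_map_in_dual:
  assumes "linear_on X Y f" and "u \<in> carr (dual Y)" and "vector_space (scl X)" and "module.subspace (scl X) (carr X)"
  shows "dual_map X f u \<in> carr (dual X)"
proof -
  interpret vector_space "scl X" by fact
  show ?thesis using assms
    by (auto simp: dual_def dual_map_def linear_on_def ground_def subspace_def)
qed

lemma fin_dim_space_subspace: "fin_dim_space X \<Longrightarrow> module.subspace (scl X) (carr X)"
  unfolding fin_dim_space_def using module.subspace_span module_iff_vector_space by metis

lemma tensor_map_tens:
  assumes "fin_dim_space X" "fin_dim_space Y" "linear_on X X' f" "linear_on Y Y' g"
    and "x \<in> carr X" "y \<in> carr Y"
  shows "tensor_map X Y X' Y' f g (tens X Y x y) = tens X' Y' (f x) (g y)"
proof -
  have X: "vector_space (scl X)" "module.subspace (scl X) (carr X)"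
    and Y: "vector_space (scl Y)" "module.subspace (scl Y) (carr Y)"
    using assms(1,2) fin_dim_space_subspace fin_dim_space_def by blast+
  show ?thesis
    using dual_map_in_dual[OF assms(3) _ X] dual_map_in_dual[OF assms(4) _ Y] assms(5,6)
    by (auto simp: tensor_map_def tens_def fun_eq_iff dual_map_def)
qed

lemma swap_tens: "swap (tens X Y x y) = tens Y X y x"
  by (auto simp: swap_def tens_def fun_eq_iff)

lemma dual_basis:
  assumes "fin_dim_space X"
  obtains B e where "finite B" "B \<subseteq> carr X" "\<And>b. b \<in> B \<Longrightarrow> e b \<in> carr (dual X)"
    "\<And>x. x \<in> carr X \<Longrightarrow> x = (\<Sum>b\<in>B. scl X (e b x) b)"
proof -
  obtain S where vs: "vector_space (scl X)" and S: "finite S" "carr X = module.span (scl X) S"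
    using assms unfolding fin_dim_space_def by blast
  interpret vector_space "scl X" by fact
  obtain B where B: "B \<subseteq> S" "independent B" "S \<subseteq> span B"
    by (rule maximal_independent_subset)
  have span: "span B = carr X"
    using B S by (metis span_eq span_mono span_span subset_trans span_superset)
  define e where "e b x = (if x \<in> carr X then representation B x b else 0)" for b x
  show thesis
  proof
    show finB: "finite B" using B(1) S(1) finite_subset by blast
    show "B \<subseteq> carr X" using span span_superset by blast
    show "e b \<in> carr (dual X)" for b
      unfolding carr_dual_iff linear_on_def ground_def e_def span[symmetric]
      by (auto simp: representation_add[OF B(2)] representation_scale[OF B(2)] span_add span_scale)
    show "x = (\<Sum>b\<in>B. scl X (e b x) b)" if "x \<in> carr X" for x
      using sum_representation_eq[OF B(2), of x B] that span finB by (simp add: e_def)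
  qed
qed

lemma linear_on_sum:
  assumes "linear_on X Y f" "vector_space (scl X)" "module.subspace (scl X) (carr X)"
    "vector_space (scl Y)" "finite I" "\<And>i. i \<in> I \<Longrightarrow> v i \<in> carr X"
  shows "f (\<Sum>i\<in>I. scl X (c i) (v i)) = (\<Sum>i\<in>I. scl Y (c i) (f (v i)))"
  using assms(5,6)
proof (induction rule: finite_induct)
  interpret X: vector_space "scl X" by fact
  interpret Y: vector_space "scl Y" by fact
  case empty
  have "f (scl X 0 0) = scl Y 0 (f 0)"
    using assms(1,3) unfolding linear_on_def by (metis X.subspace_0)
  then show ?case by simp
next
  interpret X: vector_space "scl X" by fact
  case (insert i I)
  have "scl X (c i) (v i) \<in> carr X" "(\<Sum>i\<in>I. scl X (c i) (v i)) \<in> carr X"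
    using insert assms(3) by (auto intro: X.subspace_scale X.subspace_sum)
  then show ?case
    using insert assms(1) by (simp add: linear_on_def)
qed

lemma bidual_bij:
  assumes fX: "fin_dim_space X"
  shows "bij_betw (ev X) (carr X) (carr (dual (dual X)))"
proof -
  have vX: "vector_space (scl X)" "module.subspace (scl X) (carr X)"
    using fX fin_dim_space_subspace fin_dim_space_def by blast+
  interpret X: vector_space "scl X" by (rule vX)
  interpret D: vector_space "scl (dual X)"
    by unfold_locales (auto simp: dual_def fun_eq_iff algebra_simps)
  have sD: "D.subspace (carr (dual X))"
    unfolding D.subspace_def
    by (auto simp: dual_def linear_on_def ground_def algebra_simps)
  obtain B e where B: "finite B" "B \<subseteq> carr X" "\<And>b. b \<in> B \<Longrightarrow> e b \<in> carr (dual X)"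
    and ex: "\<And>x. x \<in> carr X \<Longrightarrow> x = (\<Sum>b\<in>B. scl X (e b x) b)"
    using dual_basis[OF fX] by blast
  have ground: "vector_space (scl (ground :: ('a, 'a) vspace))"
    by unfold_locales (auto simp: ground_def algebra_simps)
  have val: "u x = (\<Sum>b\<in>B. e b x * u b)" if "u \<in> carr (dual X)" "x \<in> carr X" for u x
    using linear_on_sum[of X ground u B "\<lambda>b. b" "\<lambda>b. e b x"] ex[OF that(2), symmetric] that(1) B(1)
      subsetD[OF B(2)] vX ground
    by (simp add: carr_dual_iff ground_def)
  show ?thesis
    unfolding bij_betw_def
  proof
    show "inj_on (ev X) (carr X)"
    proof (rule inj_onI)
      fix x y assume xy: "x \<in> carr X" "y \<in> carr X" "ev X x = ev X y"
      then have "e b x = e b y" if "b \<in> B" for b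
        using B(3)[OF that] by (metis ev_def)
      then have "(\<Sum>b\<in>B. scl X (e b x) b) = (\<Sum>b\<in>B. scl X (e b y) b)" by simp
      then show "x = y" using ex[OF xy(1)] ex[OF xy(2)] by (rule box_equals[OF _ sym sym])
    qed
    show "ev X ` carr X = carr (dual (dual X))"
    proof (intro equalityI subsetI)
      fix F assume "F \<in> ev X ` carr X"
      then obtain x where "x \<in> carr X" "F = ev X x" by blast
      moreover have "linear_on (dual X) ground (ev X x)"
        unfolding linear_on_def using D.subspace_add[OF sD] D.subspace_scale[OF sD]
        by (auto simp: ev_def ground_def) (simp add: dual_def)
      ultimately show "F \<in> carr (dual (dual X))"
        by (auto simp: carr_dual_iff[of _ "dual X"] ev_def)
    next
      fix F assume F: "F \<in> carr (dual (dual X))"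
      define x where "x = (\<Sum>b\<in>B. scl X (F (e b)) b)"
      have xX: "x \<in> carr X"
        unfolding x_def using B(2) vX(2) by (auto intro!: X.subspace_sum X.subspace_scale)
      have "F = ev X x"
      proof
        fix u show "F u = ev X x u"
        proof (cases "u \<in> carr (dual X)")
          case True
          have "u = (\<Sum>b\<in>B. scl (dual X) (u b) (e b))"
          proof
            fix y
            have "(\<Sum>b\<in>B. scl (dual X) (u b) (e b)) y = (\<Sum>b\<in>B. u b * e b y)"
              using B(1) by (induction rule: finite_induct) (auto simp: dual_def)
            moreover have "e b y = 0" if "b \<in> B" "y \<notin> carr X" for b
              using B(3)[OF that(1)] that(2) by (simp add: carr_dual_iff)
            ultimately show "u y = (\<Sum>b\<in>B. scl (dual X) (u b) (e b)) y"
              using True val[of u y] by (cases "y \<in> carr X") (auto simp: carr_dual_iff mult.commute)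
          qed
          then have "F u = F (\<Sum>b\<in>B. scl (dual X) (u b) (e b))" by (rule arg_cong)
          also have "\<dots> = (\<Sum>b\<in>B. u b * F (e b))"
            using linear_on_sum[of "dual X" ground F B e u] F B(1,3) D.vector_space_axioms sD ground
            by (auto simp: carr_dual_iff[of _ "dual X"] ground_def)
          also have "\<dots> = u x"
            unfolding x_def
            using linear_on_sum[of X ground u B "\<lambda>b. b" "\<lambda>b. F (e b)"] True B(1) subsetD[OF B(2)] vX ground
            by (simp add: carr_dual_iff ground_def mult.commute)
          finally show ?thesis using True by (simp add: ev_def)
        next
          case False
          then show ?thesis using F by (simp add: carr_dual_iff[of _ "dual X"] ev_def)
        qed
      qed
      then show "F \<in> ev X ` carr X" using xX by blast
    qed
  qed
qed

lemma tensor_universal: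
  assumes fX: "fin_dim_space X" and fY: "fin_dim_space Y" and vZ: "vector_space (scl Z)"
    and sZ: "module.subspace (scl Z) (carr Z)" and bil: "bilinear_on X Y Z \<beta>"
  shows "\<exists>F. linear_on (tensor_space X Y) Z F \<and>
    (\<forall>x\<in>carr X. \<forall>y\<in>carr Y. F (tens X Y x y) = \<beta> x y) \<and>
    (\<forall>G. linear_on (tensor_space X Y) Z G \<and>
      (\<forall>x\<in>carr X. \<forall>y\<in>carr Y. G (tens X Y x y) = \<beta> x y) \<longrightarrow>
      (\<forall>t\<in>carr (tensor_space X Y). G t = F t))"
proof -
  have vX: "vector_space (scl X)" "module.subspace (scl X) (carr X)"
    and vY: "vector_space (scl Y)" "module.subspace (scl Y) (carr Y)"
    using fX fY fin_dim_space_subspace fin_dim_space_def by blast+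
  interpret Z: vector_space "scl Z" by fact
  interpret T: vector_space "\<lambda>c t (f::'b \<Rightarrow> 'a) (g::'c \<Rightarrow> 'a). c * t f g"
    by (rule vector_space_tensor_scale)
  obtain B e where B: "finite B" "B \<subseteq> carr X" "\<And>b. b \<in> B \<Longrightarrow> e b \<in> carr (dual X)"
    and ex: "\<And>x. x \<in> carr X \<Longrightarrow> x = (\<Sum>b\<in>B. scl X (e b x) b)"
    using dual_basis[OF fX] by blast
  obtain C f where C: "finite C" "C \<subseteq> carr Y" "\<And>c. c \<in> C \<Longrightarrow> f c \<in> carr (dual Y)"
    and fy: "\<And>y. y \<in> carr Y \<Longrightarrow> y = (\<Sum>c\<in>C. scl Y (f c y) c)"
    using dual_basis[OF fY] by blast
  define F where "F t = (\<Sum>b\<in>B. \<Sum>c\<in>C. scl Z (t (e b) (f c)) (\<beta> b c))" for t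
  have \<beta>Z: "\<beta> b c \<in> carr Z" if "b \<in> carr X" "c \<in> carr Y" for b c
    using bil that by (auto simp: bilinear_on_def linear_on_def)
  have lin: "linear_on (tensor_space X Y) Z F"
    unfolding linear_on_def F_def
    using subsetD[OF B(2)] subsetD[OF C(2)] \<beta>Z sZ
    by (auto simp: tensor_space_def Z.scale_left_distrib sum.distrib Z.scale_sum_right
        intro!: Z.subspace_sum Z.subspace_scale)
  have tens: "F (tens X Y x y) = \<beta> x y" if x: "x \<in> carr X" and y: "y \<in> carr Y" for x y
  proof -
    have "F (tens X Y x y) = (\<Sum>b\<in>B. scl Z (e b x) (\<Sum>c\<in>C. scl Z (f c y) (\<beta> b c)))"
      unfolding F_def using B C by (auto simp: tens_def Z.scale_sum_right intro!: sum.cong)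
    also have "\<dots> = (\<Sum>b\<in>B. scl Z (e b x) (\<beta> b y))"
    proof (intro sum.cong refl)
      fix b assume "b \<in> B"
      then have "linear_on Y Z (\<beta> b)" using bil B(2) by (auto simp: bilinear_on_def)
      have "\<beta> b y = \<beta> b (\<Sum>c\<in>C. scl Y (f c y) c)"
        using fy[OF y] by (rule arg_cong)
      also have "\<dots> = (\<Sum>c\<in>C. scl Z (f c y) (\<beta> b c))"
        using \<open>linear_on Y Z (\<beta> b)\<close> vY vZ C(1) subsetD[OF C(2)] by (rule linear_on_sum)
      finally show "scl Z (e b x) (\<Sum>c\<in>C. scl Z (f c y) (\<beta> b c)) = scl Z (e b x) (\<beta> b y)"
        by (rule arg_cong[OF sym])
    qed
    also have "\<dots> = \<beta> x y"
    proof -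
      have "linear_on X Z (\<lambda>x. \<beta> x y)" using bil y by (auto simp: bilinear_on_def)
      from linear_on_sum[OF this vX vZ B(1), of "\<lambda>b. b" "\<lambda>b. e b x"]
      have "\<beta> (\<Sum>b\<in>B. scl X (e b x) b) y = (\<Sum>b\<in>B. scl Z (e b x) (\<beta> b y))"
        using subsetD[OF B(2)] by blast
      then show ?thesis using ex[OF x] by metis
    qed
    finally show ?thesis .
  qed
  have uniq: "G t = F t" if G: "linear_on (tensor_space X Y) Z G"
    "\<forall>x\<in>carr X. \<forall>y\<in>carr Y. G (tens X Y x y) = \<beta> x y" and t: "t \<in> carr (tensor_space X Y)" for G t
  proof -
    let ?E = "{tens X Y x y | x y. x \<in> carr X \<and> y \<in> carr Y}"
    have "t \<in> T.span ?E" using t by (simp add: tensor_space_def)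
    moreover have "T.subspace {t \<in> T.span ?E. G t = F t}"
    proof -
      have "G 0 = F 0"
      proof -
        have z: "0 \<in> carr (tensor_space X Y)" by (simp add: tensor_space_def T.span_zero)
        have "G (0 + 0) = G 0 + G 0" "F (0 + 0) = F 0 + F 0"
          using G(1) lin z unfolding linear_on_def by blast+
        then show ?thesis by simp
      qed
      then show ?thesis
        using G(1) lin unfolding T.subspace_def linear_on_def tensor_space_def
        by (auto intro: T.span_add T.span_scale T.span_zero)
    qed
    ultimately have "t \<in> {t \<in> T.span ?E. G t = F t}"
      by (rule T.span_subspace_induct) (use G(2) tens in \<open>auto intro: T.span_base\<close>)
    then show ?thesis by simp
  qed
  show ?thesis using lin tens uniq by blast
qed

lemma flatten_tens:
  fixes X :: "('k::field, 'a::ab_group_add) vspace"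
  assumes "x \<in> carr X" "y \<in> carr X" "z \<in> carr X"
  shows "flatten_left X (tens (tensor_space X X) X (tens X X x y) z) = tens3 X x y z"
    and "flatten_right X (tens X (tensor_space X X) x (tens X X y z)) = tens3 X x y z"
proof -
  interpret T: vector_space "\<lambda>c t (f::'a \<Rightarrow> 'k) (g::'a \<Rightarrow> 'k). c * t f g"
    by (rule vector_space_tensor_scale)
  have dual: "tens_functional X f g \<in> carr (dual (tensor_space X X))" for f g
    by (auto simp: carr_dual_iff linear_on_def tens_functional_def tensor_pairing_def ground_def
        tensor_space_def T.span_add T.span_scale)
  have val: "tens_functional X f g (tens X X x y) =
      (if f \<in> carr (dual X) \<and> g \<in> carr (dual X) then f x * g y else 0)"
    if "x \<in> carr X" "y \<in> carr X" for x y f g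
    using tens_in_tensor_space[OF that] by (simp add: tens_functional_def tensor_pairing_def tens_def)
  show "flatten_left X (tens (tensor_space X X) X (tens X X x y) z) = tens3 X x y z"
    using dual val assms by (auto simp: flatten_left_def tens3_def fun_eq_iff tens_def[of "tensor_space X X"])
  show "flatten_right X (tens X (tensor_space X X) x (tens X X y z)) = tens3 X x y z"
    using dual val assms by (auto simp: flatten_right_def tens3_def fun_eq_iff tens_def[of _ "tensor_space X X"])
qed

end

theory Submission
  imports Defs
begin

text \<open>
  All the structure maps are adjoint to each other under the pairing of \<open>A\<close> with its dual, so every
  equation in the three conditions is equivalent to a scalar identity in two vectors \<open>x, y\<close> and two
  functionals \<open>a, b\<close>.  An equation between tensors over \<open>A\<close> is evaluated at \<open>(a, b)\<close>, one between
  tensors over the dual at the images of \<open>x\<close> and \<open>y\<close> in the bidual, one between functionals at a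
  vector, and one between vectors at all functionals, which separate points.

  For fixed \<open>x, y, a, b\<close> there are only six such identities.  The six equations of a D-bialgebra
  give one each (\<open>comult_conditions_iff\<close>).  Condition (b) keeps the first three and replaces the
  others by equations on the dual side: those for \<open>\<delta>\<^sub>\<prec>\<close>, \<open>\<delta>\<^sub>\<succ>\<close> and their mixed
  equation give the last three (\<open>dual_comult_conditions_iff\<close>): the equations for the sum
  \<open>\<Delta>\<^sub>\<succ> + \<Delta>\<^sub>\<prec>\<close> and those for the two \<open>\<delta>\<close> are the same statements read from opposite sides of
  the pairing.  The six equations of a matched pair give the same six identities up to sign and the
  order of the arguments (\<open>matched_pair_iff\<close>).  What makes different-looking
  terms agree is always one step, moving an operator across a product (\<open>pairing_transfer\<close>):
  \<open>\<langle>b, x \<circ> g\<^sup>*(y)\<rangle> = \<langle>L\<^sub>\<circ>\<^sup>*(x) b, g\<^sup>*(y)\<rangle> = \<langle>g(L\<^sub>\<circ>\<^sup>*(x) b), y\<rangle>\<close>.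

  The remaining requirements hold unconditionally.  The coalgebra axioms are the dual form of the
  axioms of the structure on the dual space (\<open>dual_coalgebra\<close>), the associated products are
  associative (\<open>associated_associative\<close>), and the negated transposes of \<open>R\<^sub>\<prec>\<close> and \<open>L\<^sub>\<succ>\<close> always
  form a bimodule (\<open>dual_bimodule\<close>, \<open>predual_bimodule\<close>).
\<close>

section \<open>Linear maps, functionals and transposes\<close>

lemma carr_closed:
  assumes "fin_dim_space X"
  shows zero_in_carr: "0 \<in> carr X"
    and add_in_carr: "x \<in> carr X \<Longrightarrow> y \<in> carr X \<Longrightarrow> x + y \<in> carr X"
    and neg_in_carr: "x \<in> carr X \<Longrightarrow> - x \<in> carr X"
    and diff_in_carr: "x \<in> carr X \<Longrightarrow> y \<in> carr X \<Longrightarrow> x - y \<in> carr X"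
    and scl_in_carr: "x \<in> carr X \<Longrightarrow> scl X c x \<in> carr X"
proof -
  interpret vector_space "scl X" using assms by (simp add: fin_dim_space_def)
  have s: "subspace (carr X)" by (rule fin_dim_space_subspace[OF assms])
  show "0 \<in> carr X" using s by (rule subspace_0)
  show "x \<in> carr X \<Longrightarrow> y \<in> carr X \<Longrightarrow> x + y \<in> carr X" using s by (rule subspace_add)
  show "x \<in> carr X \<Longrightarrow> - x \<in> carr X" using s by (rule subspace_neg)
  show "x \<in> carr X \<Longrightarrow> y \<in> carr X \<Longrightarrow> x - y \<in> carr X" using s by (rule subspace_diff)
  show "x \<in> carr X \<Longrightarrow> scl X c x \<in> carr X" using s by (rule subspace_scale)
qed

lemma linear_on_zero:
  assumes "linear_on X Y f" "fin_dim_space X"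
  shows "f 0 = 0"
proof -
  have "f (0 + 0) = f 0 + f 0"
    using assms(1) zero_in_carr[OF assms(2)] unfolding linear_on_def by blast
  then show ?thesis by simp
qed

lemma linear_on_neg:
  assumes "linear_on X Y f" "fin_dim_space X" "x \<in> carr X"
  shows "f (- x) = - f x"
proof -
  have "f (x + - x) = f x + f (- x)"
    using assms neg_in_carr unfolding linear_on_def by blast
  then show ?thesis using linear_on_zero[OF assms(1,2)] by (simp add: eq_neg_iff_add_eq_0 add.commute)
qed

lemma scl_add: "fin_dim_space X \<Longrightarrow> scl X c (x + y) = scl X c x + scl X c y"
  by (simp add: fin_dim_space_def module.scale_right_distrib module_iff_vector_space)

lemma dual_apply:
  assumes "fin_dim_space X" "u \<in> carr (dual X)"
  shows "x \<in> carr X \<Longrightarrow> y \<in> carr X \<Longrightarrow> u (x + y) = u x + u y"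
    and "x \<in> carr X \<Longrightarrow> y \<in> carr X \<Longrightarrow> u (x - y) = u x - u y"
    and "x \<in> carr X \<Longrightarrow> u (- x) = - u x"
    and "x \<in> carr X \<Longrightarrow> u (scl X c x) = c * u x"
    and "u 0 = 0"
proof -
  have l: "linear_on X ground u" using assms(2) by (simp add: carr_dual_iff)
  show add: "u (x + y) = u x + u y" if "x \<in> carr X" "y \<in> carr X" for x y
    using l that unfolding linear_on_def by blast
  show neg: "u (- x) = - u x" if "x \<in> carr X" for x
    using linear_on_neg[OF l assms(1) that] .
  show "u (x - y) = u x - u y" if "x \<in> carr X" "y \<in> carr X" for x y
    using add[of x "- y"] neg[of y] neg_in_carr[OF assms(1)] that by simp
  show "x \<in> carr X \<Longrightarrow> u (scl X c x) = c * u x"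
    using l by (auto simp: linear_on_def ground_def)
  show "u 0 = 0" by (rule linear_on_zero[OF l assms(1)])
qed

lemma dual_eq_iff:
  "u \<in> carr (dual X) \<Longrightarrow> v \<in> carr (dual X) \<Longrightarrow> u = v \<longleftrightarrow> (\<forall>x\<in>carr X. u x = v x)"
  unfolding carr_dual_iff by (metis ext)

text \<open>Injectivity of \<open>ev X\<close>, restated: functionals separate the points of the space.\<close>

lemma carr_eq_iff:
  assumes "fin_dim_space X" "x \<in> carr X" "y \<in> carr X"
  shows "x = y \<longleftrightarrow> (\<forall>u\<in>carr (dual X). u x = u y)"
proof
  assume "\<forall>u\<in>carr (dual X). u x = u y"
  then have "ev X x = ev X y" by (auto simp: ev_def fun_eq_iff)
  then show "x = y"
    using bidual_bij[OF assms(1)] assms(2,3) unfolding bij_betw_def inj_on_def by blast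
qed simp

lemma rmul_apply: "rmul m y x = m x y"
  by (simp add: rmul_def)

lemma lmul_apply: "lmul m x y = m x y"
  by (simp add: lmul_def)

lemma dual_map_apply: "x \<in> carr X \<Longrightarrow> dual_map X f u x = u (f x)"
  by (simp add: dual_map_def)

lemma dual_map_closed:
  assumes "fin_dim_space X" "linear_on X Y f" "u \<in> carr (dual Y)"
  shows "dual_map X f u \<in> carr (dual X)"
  using dual_map_in_dual[OF assms(2,3)] assms(1) fin_dim_space_subspace fin_dim_space_def by blast

lemma dual_map_id: "u \<in> carr (dual X) \<Longrightarrow> dual_map X id u = u"
  by (auto simp: dual_map_def carr_dual_iff)

lemma scl_dual: "scl (dual X) c u x = c * u x"
  by (simp add: dual_def)

lemma ev_in_bidual: "fin_dim_space X \<Longrightarrow> x \<in> carr X \<Longrightarrow> ev X x \<in> carr (dual (dual X))"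
  using bidual_bij[of X] by (auto simp: bij_betw_def)

text \<open>Since \<open>ev X\<close> is a bijection onto the bidual, \<open>predual_map\<close> really is a transpose.\<close>

lemma predual_map_closed_and_ev:
  assumes "fin_dim_space X" "fin_dim_space (dual X)" "linear_on (dual X) (dual X) g" "x \<in> carr X"
  shows predual_map_closed: "predual_map X g x \<in> carr X"
    and ev_predual_map: "dual_map (dual X) g (ev X x) = ev X (predual_map X g x)"
proof -
  have mem: "dual_map (dual X) g (ev X x) \<in> ev X ` carr X"
    using dual_map_closed[OF assms(2,3) ev_in_bidual[OF assms(1,4)]] bidual_bij[OF assms(1)]
    by (simp add: bij_betw_def)
  have inj: "inj_on (ev X) (carr X)" using bidual_bij[OF assms(1)] by (simp add: bij_betw_def)
  show "predual_map X g x \<in> carr X"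
    unfolding predual_map_def using the_inv_into_into[OF inj mem subset_refl] .
  show "dual_map (dual X) g (ev X x) = ev X (predual_map X g x)"
    unfolding predual_map_def using f_the_inv_into_f[OF inj mem] by simp
qed

lemma predual_map_pairing:
  assumes "fin_dim_space X" "fin_dim_space (dual X)" "linear_on (dual X) (dual X) g" "x \<in> carr X"
    and "u \<in> carr (dual X)"
  shows "u (predual_map X g x) = g u x"
proof -
  have "g u \<in> carr (dual X)" using assms(3,5) by (auto simp: linear_on_def)
  with fun_cong[OF ev_predual_map[OF assms(1-4)], of u] assms(5) show ?thesis
    by (simp add: ev_def dual_map_def)
qed

section \<open>Tensors as functions of two functionals\<close>

definition supported_on_dual ::
  "('k::field, 'a::ab_group_add) vspace \<Rightarrow> (('a \<Rightarrow> 'k) \<Rightarrow> ('a \<Rightarrow> 'k) \<Rightarrow> 'k) \<Rightarrow> bool" where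
  "supported_on_dual X t \<longleftrightarrow> (\<forall>u v. u \<notin> carr (dual X) \<or> v \<notin> carr (dual X) \<longrightarrow> t u v = 0)"

lemma supported_on_dual_intros:
  "supported_on_dual X 0"
  "supported_on_dual X s \<Longrightarrow> supported_on_dual X t \<Longrightarrow> supported_on_dual X (s + t)"
  "supported_on_dual X s \<Longrightarrow> supported_on_dual X t \<Longrightarrow> supported_on_dual X (s - t)"
  "supported_on_dual X t \<Longrightarrow> supported_on_dual X (swap t)"
  "supported_on_dual X (tmap X f g t)"
  by (auto simp: supported_on_dual_def swap_def tensor_map_def)

text \<open>Tensors vanish off pairs of functionals, so they can be compared by their pairings alone.\<close>

lemma tensor_supported:
  fixes X :: "('k::field, 'a::ab_group_add) vspace"
  assumes "t \<in> carr (tensor_space X X)"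
  shows "supported_on_dual X t"
proof -
  interpret T: vector_space "\<lambda>c t (f::'a \<Rightarrow> 'k) (g::'a \<Rightarrow> 'k). c * t f g"
    by (rule vector_space_tensor_scale)
  have "t \<in> T.span {tens X X x y | x y. x \<in> carr X \<and> y \<in> carr X}"
    using assms by (simp add: tensor_space_def)
  moreover have "T.subspace {t. supported_on_dual X t}"
    by (auto simp: T.subspace_def supported_on_dual_def)
  ultimately have "t \<in> {t. supported_on_dual X t}"
    by (rule T.span_subspace_induct) (auto simp: supported_on_dual_def tens_def)
  then show ?thesis by simp
qed

lemma tensor_eq_iff:
  "supported_on_dual X s \<Longrightarrow> supported_on_dual X t \<Longrightarrow>
    s = t \<longleftrightarrow> (\<forall>u\<in>carr (dual X). \<forall>v\<in>carr (dual X). s u v = t u v)"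
  unfolding supported_on_dual_def fun_eq_iff by metis

lemma bidual_tensor_eq_iff:
  assumes "fin_dim_space X" "supported_on_dual (dual X) s" "supported_on_dual (dual X) t"
  shows "s = t \<longleftrightarrow> (\<forall>x\<in>carr X. \<forall>y\<in>carr X. s (ev X x) (ev X y) = t (ev X x) (ev X y))"
proof -
  have "carr (dual (dual X)) = ev X ` carr X"
    using bidual_bij[OF assms(1)] by (simp add: bij_betw_def)
  then show ?thesis using tensor_eq_iff[OF assms(2,3)] by simp
qed

lemma tmap_apply:
  "u \<in> carr (dual X) \<Longrightarrow> v \<in> carr (dual X) \<Longrightarrow>
    tmap X f g t u v = t (dual_map X f u) (dual_map X g v)"
  by (simp add: tensor_map_def)

lemma swap_apply: "swap t u v = t v u"
  by (simp add: swap_def)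

lemma comult_apply:
  assumes "comult_of_dual_product X m D" "x \<in> carr X"
  shows "a \<in> carr (dual X) \<Longrightarrow> b \<in> carr (dual X) \<Longrightarrow> D x a b = m a b x"
    and "supported_on_dual X (D x)"
  using assms tensor_supported[of "D x" X]
  by (auto simp: comult_of_dual_product_def tensor_pairing_def linear_on_def)

lemma dual_comult_apply:
  assumes "dual_comult_of_product X m \<delta>" "a \<in> carr (dual X)"
  shows "x \<in> carr X \<Longrightarrow> y \<in> carr X \<Longrightarrow> \<delta> a (ev X x) (ev X y) = a (m x y)"
    and "supported_on_dual (dual X) (\<delta> a)"
  using assms tensor_supported[of "\<delta> a" "dual X"]
  by (auto simp: dual_comult_of_product_def tensor_pairing_def linear_on_def)

lemma comult_add:
  fixes X :: "('k::field, 'a::ab_group_add) vspace"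
  assumes "fin_dim_space X" "comult_of_dual_product X m D" "comult_of_dual_product X n E"
  shows "comult_of_dual_product X (add_op m n) (\<lambda>x. D x + E x)"
proof -
  interpret T: vector_space "\<lambda>c t (f::'a \<Rightarrow> 'k) (g::'a \<Rightarrow> 'k). c * t f g"
    by (rule vector_space_tensor_scale)
  show ?thesis using assms
    by (auto simp: comult_of_dual_product_def linear_on_def tensor_space_def add_op_def
        tensor_pairing_def fun_eq_iff algebra_simps intro: T.span_add)
qed

section \<open>Bilinear products\<close>

lemma bilinear_onD:
  assumes "bilinear_on X X X m" "fin_dim_space X"
  shows bilinear_closed: "x \<in> carr X \<Longrightarrow> y \<in> carr X \<Longrightarrow> m x y \<in> carr X"
    and bilinear_lmul: "x \<in> carr X \<Longrightarrow> linear_on X X (lmul m x)"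
    and bilinear_rmul: "y \<in> carr X \<Longrightarrow> linear_on X X (rmul m y)"
    and bilinear_add_left: "x \<in> carr X \<Longrightarrow> y \<in> carr X \<Longrightarrow> z \<in> carr X \<Longrightarrow> m (x + y) z = m x z + m y z"
    and bilinear_add_right: "x \<in> carr X \<Longrightarrow> y \<in> carr X \<Longrightarrow> z \<in> carr X \<Longrightarrow> m x (y + z) = m x y + m x z"
    and bilinear_scl_left: "x \<in> carr X \<Longrightarrow> y \<in> carr X \<Longrightarrow> m (scl X c x) y = scl X c (m x y)"
    and bilinear_scl_right: "x \<in> carr X \<Longrightarrow> y \<in> carr X \<Longrightarrow> m x (scl X c y) = scl X c (m x y)"
    and bilinear_neg_left: "x \<in> carr X \<Longrightarrow> y \<in> carr X \<Longrightarrow> m (- x) y = - m x y"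
    and bilinear_neg_right: "x \<in> carr X \<Longrightarrow> y \<in> carr X \<Longrightarrow> m x (- y) = - m x y"
proof -
  show l: "x \<in> carr X \<Longrightarrow> linear_on X X (lmul m x)" for x
    using assms(1) by (simp add: bilinear_on_def lmul_def)
  show r: "y \<in> carr X \<Longrightarrow> linear_on X X (rmul m y)" for y
    using assms(1) by (simp add: bilinear_on_def rmul_def)
  show "x \<in> carr X \<Longrightarrow> y \<in> carr X \<Longrightarrow> m (- x) y = - m x y"
    using linear_on_neg[OF r assms(2)] by (simp add: rmul_def)
  show "x \<in> carr X \<Longrightarrow> y \<in> carr X \<Longrightarrow> m x (- y) = - m x y"
    using linear_on_neg[OF l assms(2)] by (simp add: lmul_def)
qed (use assms(1) in \<open>simp_all add: bilinear_on_def linear_on_def\<close>)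

lemma bilinear_add_op:
  assumes "bilinear_on X X X m" "bilinear_on X X X n" "fin_dim_space X"
  shows "bilinear_on X X X (add_op m n)"
  using assms(1,2) add_in_carr[OF assms(3)]
  by (auto simp: bilinear_on_def linear_on_def add_op_def algebra_simps scl_add[OF assms(3)])

lemma anti_dendriformD:
  assumes "anti_dendriform_algebra X s p"
  shows "fin_dim_space X" "bilinear_on X X X s" "bilinear_on X X X p"
    and "bilinear_on X X X (add_op s p)"
  using assms bilinear_add_op by (auto simp: anti_dendriform_algebra_def)

text \<open>The axioms make \<open>x \<succ> (y \<succ> z) + x \<prec> (y \<cdot> z)\<close> and \<open>(x \<cdot> y) \<succ> z + (x \<prec> y) \<prec> z\<close> vanish, so
  both ways of bracketing \<open>x \<cdot> y \<cdot> z\<close> reduce to \<open>(x \<succ> y) \<prec> z = x \<succ> (y \<prec> z)\<close>.\<close>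

lemma associated_associative:
  assumes "anti_dendriform_algebra X s p"
  shows "associative_algebra X (add_op s p)"
proof -
  note d = anti_dendriformD[OF assms]
  have "add_op s p (add_op s p x y) z = add_op s p x (add_op s p y z)"
    if c: "x \<in> carr X" "y \<in> carr X" "z \<in> carr X" for x y z
  proof -
    note cl = bilinear_closed[OF d(2,1)] bilinear_closed[OF d(3,1)]
    have ax: "s x (s y z) = - s (add_op s p x y) z" "s x (s y z) = - p x (add_op s p y z)"
      "s x (s y z) = p (p x y) z" "p (s x y) z = s x (p y z)"
      using assms c unfolding anti_dendriform_algebra_def by metis+
    have "add_op s p (add_op s p x y) z = s (add_op s p x y) z + (p (s x y) z + p (p x y) z)"
      using c cl bilinear_add_left[OF d(3,1), of "s x y" "p x y" z]
      by (simp add: add_op_def)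
    also have "\<dots> = s x (p y z)" using ax by simp
    also have "\<dots> = (s x (s y z) + s x (p y z)) + p x (add_op s p y z)" using ax by simp
    also have "\<dots> = add_op s p x (add_op s p y z)"
      using c cl bilinear_add_right[OF d(2,1), of x "s y z" "p y z"]
      by (simp add: add_op_def)
    finally show ?thesis .
  qed
  then show ?thesis using d by (simp add: associative_algebra_def)
qed

section \<open>The dual bimodules\<close>

text \<open>The pairing turns the three bimodule laws for \<open>(- R\<^sub>\<prec>\<^sup>*, - L\<^sub>\<succ>\<^sup>*)\<close> into the axioms
  \<open>z \<prec> (x \<cdot> y) = - (z \<prec> x) \<prec> y\<close>, \<open>(x \<cdot> y) \<succ> z = - x \<succ> (y \<succ> z)\<close> and
  \<open>y \<succ> (z \<prec> x) = (y \<succ> z) \<prec> x\<close>; the signs are those of the two anti-associative laws.\<close>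

lemma dual_bimodule:
  assumes "anti_dendriform_algebra X s p" and fd: "fin_dim_space (dual X)"
  shows "bimodule X (add_op s p) (dual X)
    (\<lambda>x. - dual_map X (rmul p x)) (\<lambda>x. - dual_map X (lmul s x))"
proof -
  note d = anti_dendriformD[OF assms(1)]
  note cl = bilinear_closed[OF d(2,1)] bilinear_closed[OF d(3,1)] bilinear_closed[OF d(4,1)]
  have tr: "dual_map X (rmul p x) u \<in> carr (dual X)" "dual_map X (lmul s x) u \<in> carr (dual X)"
    if "x \<in> carr X" "u \<in> carr (dual X)" for x u
    using that dual_map_closed[OF d(1)] bilinear_rmul[OF d(3,1)] bilinear_lmul[OF d(2,1)] by blast+
  note mem = tr carr_closed[OF d(1)] carr_closed[OF fd] cl
  note ap = dual_map_apply dual_apply[OF d(1)] rmul_apply lmul_apply scl_dual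
    bilinear_onD(4-)[OF d(2,1)] bilinear_onD(4-)[OF d(3,1)]
  have ax: "p z (add_op s p x y) = - p (p z x) y" "s (add_op s p x y) z = - s x (s y z)"
      "s y (p z x) = p (s y z) x"
    if c: "x \<in> carr X" "y \<in> carr X" "z \<in> carr X" for x y z
    using assms c unfolding anti_dendriform_algebra_def by (metis minus_minus)+
  show ?thesis
    unfolding bimodule_def bilinear_on_def linear_on_def
    by (intro conjI ballI allI; (subst dual_eq_iff[where X = X])?)
       (simp_all add: mem ap ax algebra_simps)
qed

text \<open>The same for an anti-dendriform structure on the dual, acting on the space by transposes;
  here identities of vectors are tested against functionals.\<close>

lemma predual_bimodule:
  assumes fX: "fin_dim_space X" and "anti_dendriform_algebra (dual X) s p"
  shows "bimodule (dual X) (add_op s p) X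
    (\<lambda>a. - predual_map X (rmul p a)) (\<lambda>a. - predual_map X (lmul s a))"
proof -
  note d = anti_dendriformD[OF assms(2)]
  note cl = bilinear_closed[OF d(2,1)] bilinear_closed[OF d(3,1)] bilinear_closed[OF d(4,1)]
  note lin = bilinear_rmul[OF d(3,1)] bilinear_lmul[OF d(2,1)]
  have tr: "predual_map X (rmul p a) x \<in> carr X" "predual_map X (lmul s a) x \<in> carr X"
    if "a \<in> carr (dual X)" "x \<in> carr X" for x a
    using that predual_map_closed[OF fX d(1)] lin by blast+
  have pr: "u (predual_map X (rmul p a) x) = p u a x" "u (predual_map X (lmul s a) x) = s a u x"
    if "a \<in> carr (dual X)" "x \<in> carr X" "u \<in> carr (dual X)" for x a u
    using that by (simp_all add: predual_map_pairing[OF fX d(1)] lin rmul_apply lmul_apply)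
  note mem = tr carr_closed[OF d(1)] carr_closed[OF fX] cl
  note ap = pr dual_apply[OF fX] scl_dual
    bilinear_onD(4-)[OF d(2,1)] bilinear_onD(4-)[OF d(3,1)]
  have ax: "p c (add_op s p a b) = - p (p c a) b" "s (add_op s p a b) c = - s a (s b c)"
      "s b (p c a) = p (s b c) a"
    if c: "a \<in> carr (dual X)" "b \<in> carr (dual X)" "c \<in> carr (dual X)" for a b c
    using assms(2) c unfolding anti_dendriform_algebra_def by (metis minus_minus)+
  show ?thesis
    unfolding bimodule_def bilinear_on_def linear_on_def
    by (intro conjI ballI allI; (subst carr_eq_iff[OF fX])?)
       (simp_all add: mem ap ax algebra_simps)
qed

section \<open>The coalgebra axioms\<close>

lemma tens_functional_in_dual: "tens_functional X f g \<in> carr (dual (tensor_space X X))"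
  for X :: "('k::field, 'a::ab_group_add) vspace"
proof -
  interpret T: vector_space "\<lambda>c t (f::'a \<Rightarrow> 'k) (g::'a \<Rightarrow> 'k). c * t f g"
    by (rule vector_space_tensor_scale)
  show ?thesis
    by (auto simp: carr_dual_iff linear_on_def tens_functional_def tensor_pairing_def ground_def
        tensor_space_def T.span_add T.span_scale)
qed

lemma dual_map_comult_tens_functional:
  assumes fd: "fin_dim_space (dual X)" and m: "bilinear_on (dual X) (dual X) (dual X) m"
    and D: "comult_of_dual_product X m D"
  shows "dual_map X D (tens_functional X f g) =
    (if f \<in> carr (dual X) \<and> g \<in> carr (dual X) then m f g else 0)"
proof
  fix y
  show "dual_map X D (tens_functional X f g) y =
    (if f \<in> carr (dual X) \<and> g \<in> carr (dual X) then m f g else 0) y"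
  proof (cases "y \<in> carr X")
    case True
    then have "D y \<in> carr (tensor_space X X)"
      using D by (auto simp: comult_of_dual_product_def linear_on_def)
    with True comult_apply[OF D True] show ?thesis
      by (auto simp: dual_map_def tens_functional_def tensor_pairing_def supported_on_dual_def)
  next
    case False
    with bilinear_closed[OF m fd, of f g] show ?thesis
      by (auto simp: dual_map_def carr_dual_iff)
  qed
qed

text \<open>Evaluated at three functionals, an iterated comultiplication is an iterated product.\<close>

lemma flatten_comult:
  assumes fd: "fin_dim_space (dual X)" and m: "bilinear_on (dual X) (dual X) (dual X) m"
    and n: "bilinear_on (dual X) (dual X) (dual X) n"
    and D: "comult_of_dual_product X m D"
    and E: "comult_of_dual_product X n E" and x: "x \<in> carr X"
  shows flatten_left_comult: "flatten_left X (tensor_map X X (tensor_space X X) X D id (E x)) f g h =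
      (if f \<in> carr (dual X) \<and> g \<in> carr (dual X) \<and> h \<in> carr (dual X) then n (m f g) h x else 0)"
    and flatten_right_comult: "flatten_right X (tensor_map X X X (tensor_space X X) id D (E x)) f g h =
      (if f \<in> carr (dual X) \<and> g \<in> carr (dual X) \<and> h \<in> carr (dual X) then n f (m g h) x else 0)"
proof -
  \<comment> \<open>If one of two flattened arguments is not a functional, \<open>D\<close> transposes their tensor product to \<open>0\<close>.\<close>
  have zero: "n 0 h = 0" "n h 0 = 0" if "h \<in> carr (dual X)" for h
    using linear_on_zero[OF bilinear_rmul[OF n fd that] fd]
      linear_on_zero[OF bilinear_lmul[OF n fd that] fd]
    by (simp_all add: rmul_apply lmul_apply)
  note simps = tensor_map_def tens_functional_in_dual dual_map_id
    dual_map_comult_tens_functional[OF fd m D] comult_apply(1)[OF E x]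
    bilinear_closed[OF m fd] zero_in_carr[OF fd] zero
  show "flatten_left X (tensor_map X X (tensor_space X X) X D id (E x)) f g h =
      (if f \<in> carr (dual X) \<and> g \<in> carr (dual X) \<and> h \<in> carr (dual X) then n (m f g) h x else 0)"
    by (auto simp: flatten_left_def simps)
  show "flatten_right X (tensor_map X X X (tensor_space X X) id D (E x)) f g h =
      (if f \<in> carr (dual X) \<and> g \<in> carr (dual X) \<and> h \<in> carr (dual X) then n f (m g h) x else 0)"
    by (auto simp: flatten_right_def simps)
qed

text \<open>By \<open>flatten_comult\<close> each coalgebra axiom at \<open>(f, g, h)\<close> and \<open>x\<close> is an anti-dendriform axiom for
  \<open>f, g, h\<close> in the dual, evaluated at \<open>x\<close>.\<close>

lemma dual_coalgebra:
  assumes fX: "fin_dim_space X" and alg: "anti_dendriform_algebra (dual X) s p"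
    and Ds: "comult_of_dual_product X s Ds" and Dp: "comult_of_dual_product X p Dp"
  shows "anti_dendriform_coalgebra X Ds Dp"
proof -
  note d = anti_dendriformD[OF alg]
  note D = comult_add[OF fX Ds Dp]
  note l = flatten_left_comult[OF d(1)]
  note r = flatten_right_comult[OF d(1)]
  have ax: "s f (s g h) x = - s (add_op s p f g) h x \<and>
      p f (add_op s p g h) x = s (add_op s p f g) h x \<and>
      p (p f g) h x = - s (add_op s p f g) h x \<and> p (s f g) h x = s f (p g h) x"
    if "f \<in> carr (dual X)" "g \<in> carr (dual X)" "h \<in> carr (dual X)" for f g h x
  proof -
    have "s f (s g h) = - s (add_op s p f g) h" "- s (add_op s p f g) h = - p f (add_op s p g h)"
      "- p f (add_op s p g h) = p (p f g) h" "p (s f g) h = s f (p g h)"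
      using alg that unfolding anti_dendriform_algebra_def by blast+
    from this[THEN fun_cong, of x] show ?thesis by simp
  qed
  show ?thesis
    unfolding anti_dendriform_coalgebra_def Let_def
    using fX Ds Dp ax
    by (auto simp: comult_of_dual_product_def fun_eq_iff
        l[OF d(2,3) Ds Dp] l[OF d(3,3) Dp Dp] l[OF d(4,2) D Ds]
        r[OF d(2,2) Ds Ds] r[OF d(3,2) Dp Ds] r[OF d(4,3) D Dp])
qed

section \<open>Six scalar identities\<close>

locale dual_anti_dendriform_algebras =
  fixes A :: "('k::field, 'a::ab_group_add) vspace"
    and succ prec :: "'a \<Rightarrow> 'a \<Rightarrow> 'a"
    and succ' prec' :: "('a \<Rightarrow> 'k) \<Rightarrow> ('a \<Rightarrow> 'k) \<Rightarrow> ('a \<Rightarrow> 'k)"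
  assumes alg: "anti_dendriform_algebra A succ prec"
    and alg': "anti_dendriform_algebra (dual A) succ' prec'"
begin

abbreviation "dot \<equiv> add_op succ prec"
abbreviation "ast \<equiv> add_op succ' prec'"
abbreviation "tr \<equiv> dual_map A"
abbreviation "tr' \<equiv> predual_map A"

lemmas fin_dim = anti_dendriformD(1)[OF alg] anti_dendriformD(1)[OF alg']
lemmas bil = anti_dendriformD(2-4)[OF alg]
lemmas bil' = anti_dendriformD(2-4)[OF alg']

lemmas mul_closed = bil[THEN bilinear_closed, OF fin_dim(1)] bil'[THEN bilinear_closed, OF fin_dim(2)]
lemmas mul_linear = bil[THEN bilinear_lmul, OF fin_dim(1)] bil[THEN bilinear_rmul, OF fin_dim(1)]
lemmas mul_linear' = bil'[THEN bilinear_lmul, OF fin_dim(2)] bil'[THEN bilinear_rmul, OF fin_dim(2)]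
lemmas mul_neg = bil[THEN bilinear_neg_left, OF fin_dim(1)] bil[THEN bilinear_neg_right, OF fin_dim(1)]
  bil'[THEN bilinear_neg_left, OF fin_dim(2)] bil'[THEN bilinear_neg_right, OF fin_dim(2)]

lemmas tr_closed = mul_linear[THEN dual_map_closed[OF fin_dim(1)]]
lemmas tr'_closed = mul_linear'[THEN predual_map_closed[OF fin_dim]]
lemmas closed = mul_closed tr_closed tr'_closed carr_closed[OF fin_dim(1)] carr_closed[OF fin_dim(2)]

lemmas tr'_pairing = mul_linear'[THEN predual_map_pairing[OF fin_dim]]
lemmas ev_tr' = mul_linear'[THEN ev_predual_map[OF fin_dim]]

text \<open>The mechanism behind every comparison below: an operator on functionals, transposed into one
  argument of a product on \<open>A\<close>, is the operator itself applied after the transposed multiplication by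
  the other argument.  So products on \<open>A\<close> with coadjoint arguments turn into products on the dual.\<close>

lemma pairing_transfer:
  assumes m: "bilinear_on A A A m" and g: "linear_on (dual A) (dual A) g"
    and x: "x \<in> carr A" and y: "y \<in> carr A" and b: "b \<in> carr (dual A)"
  shows "b (m x (tr' g y)) = g (tr (lmul m x) b) y"
    and "b (m (tr' g y) x) = g (tr (rmul m x) b) y"
proof -
  have c: "tr' g y \<in> carr A" by (rule predual_map_closed[OF fin_dim g y])
  show "b (m x (tr' g y)) = g (tr (lmul m x) b) y"
    using predual_map_pairing[OF fin_dim g y dual_map_closed[OF fin_dim(1) bilinear_lmul[OF m fin_dim(1) x] b]]
    by (simp add: dual_map_apply c lmul_apply)
  show "b (m (tr' g y) x) = g (tr (rmul m x) b) y"
    using predual_map_pairing[OF fin_dim g y dual_map_closed[OF fin_dim(1) bilinear_rmul[OF m fin_dim(1) x] b]]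
    by (simp add: dual_map_apply c rmul_apply)
qed

lemmas transfer =
  mul_linear'[THEN pairing_transfer(1)[OF bil(1)]] mul_linear'[THEN pairing_transfer(2)[OF bil(1)]]
  mul_linear'[THEN pairing_transfer(1)[OF bil(2)]] mul_linear'[THEN pairing_transfer(2)[OF bil(2)]]
  mul_linear'[THEN pairing_transfer(1)[OF bil(3)]] mul_linear'[THEN pairing_transfer(2)[OF bil(3)]]

text \<open>The six D-bialgebra equations in their order, paired with \<open>a \<otimes> b\<close>.  All operators are written
  as transposes acting on functionals; this is the normal form to which the dual equations and the
  matched pair equations are brought by \<open>pairing_transfer\<close>.\<close>

definition prec_comult_of_dot where "prec_comult_of_dot x y a b \<longleftrightarrow>
  prec' a b (dot x y) = prec' (tr (rmul dot y) a) b x - prec' a (tr (lmul succ x) b) y"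

definition succ_comult_of_dot where "succ_comult_of_dot x y a b \<longleftrightarrow>
  succ' a b (dot x y) = succ' a (tr (lmul dot x) b) y - succ' (tr (rmul prec y) a) b x"

definition mixed_dot where "mixed_dot x y a b \<longleftrightarrow>
  succ' a (tr (rmul dot y) b) x + succ' (tr (lmul succ y) a) b x
    - prec' b (tr (rmul prec x) a) y - prec' (tr (lmul dot x) b) a y = 0"

definition comult_of_prec where "comult_of_prec x y a b \<longleftrightarrow>
  ast a b (prec x y) = ast (tr (rmul prec y) a) b x - succ' a (tr (lmul prec x) b) y"

definition comult_of_succ where "comult_of_succ x y a b \<longleftrightarrow>
  ast a b (succ x y) = ast a (tr (lmul succ x) b) y - prec' (tr (rmul succ y) a) b x"

definition mixed_comult where "mixed_comult x y a b \<longleftrightarrow>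
  ast (tr (lmul succ x) a) b y + succ' b (tr (rmul succ y) a) x
    - prec' (tr (lmul prec y) b) a x - ast a (tr (rmul prec x) b) y = 0"

definition compatible where "compatible \<longleftrightarrow>
  (\<forall>x\<in>carr A. \<forall>y\<in>carr A. \<forall>a\<in>carr (dual A). \<forall>b\<in>carr (dual A).
    prec_comult_of_dot x y a b \<and> succ_comult_of_dot x y a b \<and> mixed_dot x y a b \<and>
    comult_of_prec x y a b \<and> comult_of_succ x y a b \<and> mixed_comult x y a b)"

text \<open>Here \<open>p, q, r, s\<close> stand for the pairings in a matched pair equation; the actions being
  negated, it comes out as the negative of the corresponding D-bialgebra identity.\<close>

lemma neg_equation_iffs:
  fixes p q r s :: "'g::ab_group_add"
  shows "- p = r - q \<longleftrightarrow> p = q - r" and "r - p - q + s = 0 \<longleftrightarrow> p + q - r = s"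
proof -
  have "r - q = - (q - r)" by simp
  then show "- p = r - q \<longleftrightarrow> p = q - r" by (metis neg_equal_iff_equal)
  have "r - p - q + s = s - (p + q - r)" by (simp add: algebra_simps)
  then show "r - p - q + s = 0 \<longleftrightarrow> p + q - r = s" by (metis right_minus_eq)
qed

text \<open>The actions on the dual give identities of functionals, tested on a vector \<open>y\<close>; those on \<open>A\<close> give
  identities of vectors, tested on a functional \<open>b\<close>.  The variable used for testing can stand on either side of
  the product, hence the permuted arguments of some of the six identities.\<close>

lemma matched_pair_iff:
  "matched_pair A dot (dual A) ast (\<lambda>x. - tr (rmul prec x)) (\<lambda>x. - tr (lmul succ x))
    (\<lambda>a. - tr' (rmul prec' a)) (\<lambda>a. - tr' (lmul succ' a)) \<longleftrightarrow> compatible"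
proof -
  note simps = closed dual_apply[OF fin_dim(1)] mul_neg dual_map_apply tr'_pairing
    lmul_apply rmul_apply transfer
  have c1: "(- tr (rmul prec x)) (ast a b) =
      (- tr (rmul prec ((- tr' (lmul succ' a)) x))) b + ast ((- tr (rmul prec x)) a) b
      \<longleftrightarrow> (\<forall>y\<in>carr A. comult_of_prec y x a b)"
    if "x \<in> carr A" "a \<in> carr (dual A)" "b \<in> carr (dual A)" for x a b
    using that
    by (subst dual_eq_iff[where X = A], simp add: simps, simp add: simps, intro ball_cong refl)
      (simp add: simps comult_of_prec_def neg_equation_iffs)
  have c2: "(- tr (lmul succ x)) (ast a b) =
      (- tr (lmul succ ((- tr' (rmul prec' b)) x))) a + ast a ((- tr (lmul succ x)) b)
      \<longleftrightarrow> (\<forall>y\<in>carr A. comult_of_succ x y a b)"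
    if "x \<in> carr A" "a \<in> carr (dual A)" "b \<in> carr (dual A)" for x a b
    using that
    by (subst dual_eq_iff[where X = A], simp add: simps, simp add: simps, intro ball_cong refl)
      (simp add: simps comult_of_succ_def neg_equation_iffs)
  have c3: "(- tr' (rmul prec' a)) (dot x y) =
      (- tr' (rmul prec' ((- tr (lmul succ x)) a))) y + dot ((- tr' (rmul prec' a)) x) y
      \<longleftrightarrow> (\<forall>b\<in>carr (dual A). prec_comult_of_dot x y b a)"
    if "x \<in> carr A" "y \<in> carr A" "a \<in> carr (dual A)" for x y a
    using that
    by (subst carr_eq_iff[OF fin_dim(1)], simp add: simps, simp add: simps, intro ball_cong refl)
      (simp add: simps prec_comult_of_dot_def neg_equation_iffs)
  have c4: "(- tr' (lmul succ' a)) (dot x y) =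
      (- tr' (lmul succ' ((- tr (rmul prec y)) a))) x + dot x ((- tr' (lmul succ' a)) y)
      \<longleftrightarrow> (\<forall>b\<in>carr (dual A). succ_comult_of_dot x y a b)"
    if "x \<in> carr A" "y \<in> carr A" "a \<in> carr (dual A)" for x y a
    using that
    by (subst carr_eq_iff[OF fin_dim(1)], simp add: simps, simp add: simps, intro ball_cong refl)
      (simp add: simps succ_comult_of_dot_def neg_equation_iffs)
  have c5: "(- tr (rmul prec ((- tr' (rmul prec' a)) x))) b + ast ((- tr (lmul succ x)) a) b
      - (- tr (lmul succ ((- tr' (lmul succ' b)) x))) a - ast a ((- tr (rmul prec x)) b) = 0
      \<longleftrightarrow> (\<forall>y\<in>carr A. mixed_comult x y a b)"
    if "x \<in> carr A" "a \<in> carr (dual A)" "b \<in> carr (dual A)" for x a b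
    using that
    by (subst dual_eq_iff[where X = A], simp add: simps, simp add: simps, intro ball_cong refl)
      (simp add: simps mixed_comult_def neg_equation_iffs)
  have c6: "(- tr' (rmul prec' ((- tr (rmul prec x)) a))) y + dot ((- tr' (lmul succ' a)) x) y
      - (- tr' (lmul succ' ((- tr (lmul succ y)) a))) x - dot x ((- tr' (rmul prec' a)) y) = 0
      \<longleftrightarrow> (\<forall>b\<in>carr (dual A). mixed_dot x y a b)"
    if "x \<in> carr A" "y \<in> carr A" "a \<in> carr (dual A)" for x y a
    using that
    by (subst carr_eq_iff[OF fin_dim(1)], simp add: simps, simp add: simps, intro ball_cong refl)
      (simp add: simps mixed_dot_def neg_equation_iffs)
  show ?thesis
    using associated_associative[OF alg] associated_associative[OF alg']
      dual_bimodule[OF alg fin_dim(2)] predual_bimodule[OF fin_dim(1) alg']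
    unfolding matched_pair_def compatible_def
    by (simp only: c1 c2 c3 c4 c5 c6 cong: ball_cong) blast
qed

context
  fixes \<Delta>s \<Delta>p :: "'a \<Rightarrow> ('a \<Rightarrow> 'k) \<Rightarrow> ('a \<Rightarrow> 'k) \<Rightarrow> 'k"
    and \<delta>s \<delta>p :: "('a \<Rightarrow> 'k) \<Rightarrow> (('a \<Rightarrow> 'k) \<Rightarrow> 'k) \<Rightarrow> (('a \<Rightarrow> 'k) \<Rightarrow> 'k) \<Rightarrow> 'k"
  assumes \<Delta>s: "comult_of_dual_product A succ' \<Delta>s" and \<Delta>p: "comult_of_dual_product A prec' \<Delta>p"
    and \<delta>s: "dual_comult_of_product A succ \<delta>s" and \<delta>p: "dual_comult_of_product A prec \<delta>p"
begin

lemma comult_conditions_iff: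
  assumes "x \<in> carr A" "y \<in> carr A"
  shows "\<Delta>p (dot x y) = tmap A (rmul dot y) id (\<Delta>p x) - tmap A id (lmul succ x) (\<Delta>p y) \<longleftrightarrow>
      (\<forall>a\<in>carr (dual A). \<forall>b\<in>carr (dual A). prec_comult_of_dot x y a b)" (is ?th1)
    and "\<Delta>s (dot x y) = tmap A id (lmul dot x) (\<Delta>s y) - tmap A (rmul prec y) id (\<Delta>s x) \<longleftrightarrow>
      (\<forall>a\<in>carr (dual A). \<forall>b\<in>carr (dual A). succ_comult_of_dot x y a b)" (is ?th2)
    and "tmap A id (rmul dot y) (\<Delta>s x) + tmap A (lmul succ y) id (\<Delta>s x)
        - swap (tmap A id (rmul prec x) (\<Delta>p y)) - swap (tmap A (lmul dot x) id (\<Delta>p y)) = 0 \<longleftrightarrow>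
      (\<forall>a\<in>carr (dual A). \<forall>b\<in>carr (dual A). mixed_dot x y a b)" (is ?th3)
    and "\<Delta>s (prec x y) + \<Delta>p (prec x y) =
        tmap A (rmul prec y) id (\<Delta>s x + \<Delta>p x) - tmap A id (lmul prec x) (\<Delta>s y) \<longleftrightarrow>
      (\<forall>a\<in>carr (dual A). \<forall>b\<in>carr (dual A). comult_of_prec x y a b)" (is ?th4)
    and "\<Delta>s (succ x y) + \<Delta>p (succ x y) =
        tmap A id (lmul succ x) (\<Delta>s y + \<Delta>p y) - tmap A (rmul succ y) id (\<Delta>p x) \<longleftrightarrow>
      (\<forall>a\<in>carr (dual A). \<forall>b\<in>carr (dual A). comult_of_succ x y a b)" (is ?th5)
    and "tmap A (lmul succ x) id (\<Delta>s y + \<Delta>p y) + tmap A (rmul succ y) id (swap (\<Delta>s x))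
        - tmap A id (lmul prec y) (swap (\<Delta>p x)) - tmap A id (rmul prec x) (\<Delta>s y + \<Delta>p y) = 0 \<longleftrightarrow>
      (\<forall>a\<in>carr (dual A). \<forall>b\<in>carr (dual A). mixed_comult x y a b)" (is ?th6)
proof -
  note supp = supported_on_dual_intros comult_apply(2)[OF \<Delta>s] comult_apply(2)[OF \<Delta>p] closed assms
  note simps = tmap_apply swap_apply comult_apply(1)[OF \<Delta>s] comult_apply(1)[OF \<Delta>p] closed
    dual_map_id assms
  note sum = add_op_def[of succ' prec']
  show ?th1 by (subst tensor_eq_iff[of A]) (simp_all add: supp simps prec_comult_of_dot_def)
  show ?th2 by (subst tensor_eq_iff[of A]) (simp_all add: supp simps succ_comult_of_dot_def)
  show ?th3 by (subst tensor_eq_iff[of A]) (simp_all add: supp simps mixed_dot_def)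
  show ?th4 by (subst tensor_eq_iff[of A]) (simp_all add: supp simps comult_of_prec_def sum)
  show ?th5 by (subst tensor_eq_iff[of A]) (simp_all add: supp simps comult_of_succ_def sum)
  show ?th6 by (subst tensor_eq_iff[of A]) (simp_all add: supp simps mixed_comult_def sum)
qed

text \<open>The equations for \<open>\<delta>\<^sub>\<prec>\<close> and \<open>\<delta>\<^sub>\<succ>\<close> concern the products \<open>\<prec>\<close> and \<open>\<succ>\<close> of \<open>A\<close>, to which \<open>\<delta>\<^sub>\<prec>\<close> and
  \<open>\<delta>\<^sub>\<succ>\<close> are dual, and the product \<open>\<ast>\<close>, to which \<open>\<Delta>\<close> is dual; hence they match the equations for
  \<open>\<Delta>(x \<prec> y)\<close> and \<open>\<Delta>(x \<succ> y)\<close>.\<close>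

lemma dual_comult_conditions_iff:
  assumes "a \<in> carr (dual A)" "b \<in> carr (dual A)"
  shows "\<delta>p (ast a b) =
        tmap (dual A) (rmul ast b) id (\<delta>p a) - tmap (dual A) id (lmul succ' a) (\<delta>p b) \<longleftrightarrow>
      (\<forall>x\<in>carr A. \<forall>y\<in>carr A. comult_of_prec x y a b)" (is ?th1)
    and "\<delta>s (ast a b) =
        tmap (dual A) id (lmul ast a) (\<delta>s b) - tmap (dual A) (rmul prec' b) id (\<delta>s a) \<longleftrightarrow>
      (\<forall>x\<in>carr A. \<forall>y\<in>carr A. comult_of_succ x y a b)" (is ?th2)
    and "tmap (dual A) id (rmul ast b) (\<delta>s a) + tmap (dual A) (lmul succ' b) id (\<delta>s a)
        - swap (tmap (dual A) id (rmul prec' a) (\<delta>p b)) - swap (tmap (dual A) (lmul ast a) id (\<delta>p b)) = 0 \<longleftrightarrow>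
      (\<forall>x\<in>carr A. \<forall>y\<in>carr A. mixed_comult x y a b)" (is ?th3)
proof -
  note supp = supported_on_dual_intros dual_comult_apply(2)[OF \<delta>s] dual_comult_apply(2)[OF \<delta>p] closed assms
  note simps = tmap_apply swap_apply dual_comult_apply(1)[OF \<delta>s] dual_comult_apply(1)[OF \<delta>p] closed
    dual_map_id ev_tr' ev_in_bidual[OF fin_dim(1)] transfer lmul_apply rmul_apply assms
  note ext = bidual_tensor_eq_iff[OF fin_dim(1)]
  show ?th1 by (subst ext) (simp_all add: supp simps comult_of_prec_def)
  show ?th2 by (subst ext) (simp_all add: supp simps comult_of_succ_def)
  show ?th3 by (subst ext) (simp_all add: supp simps mixed_comult_def)
qed

lemma D_bialgebra_iff:
  "anti_dendriform_D_bialgebra A succ prec \<Delta>s \<Delta>p \<longleftrightarrow> compatible"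
  using alg dual_coalgebra[OF fin_dim(1) alg' \<Delta>s \<Delta>p]
  unfolding anti_dendriform_D_bialgebra_def Let_def compatible_def
  \<comment> \<open>With \<open>right_minus_eq\<close> the mixed equations would lose the form \<open>_ - _ = 0\<close> of \<open>comult_conditions_iff\<close>.\<close>
  by (simp add: comult_conditions_iff del: right_minus_eq cong: ball_cong) blast

lemma comult_and_dual_comult_iff:
  "(\<forall>x\<in>carr A. \<forall>y\<in>carr A. \<forall>a\<in>carr (dual A). \<forall>b\<in>carr (dual A).
      \<Delta>p (dot x y) = tmap A (rmul dot y) id (\<Delta>p x) - tmap A id (lmul succ x) (\<Delta>p y) \<and>
      \<Delta>s (dot x y) = tmap A id (lmul dot x) (\<Delta>s y) - tmap A (rmul prec y) id (\<Delta>s x) \<and>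
      tmap A id (rmul dot y) (\<Delta>s x) + tmap A (lmul succ y) id (\<Delta>s x)
        - swap (tmap A id (rmul prec x) (\<Delta>p y)) - swap (tmap A (lmul dot x) id (\<Delta>p y)) = 0 \<and>
      \<delta>p (ast a b) =
        tmap (dual A) (rmul ast b) id (\<delta>p a) - tmap (dual A) id (lmul succ' a) (\<delta>p b) \<and>
      \<delta>s (ast a b) =
        tmap (dual A) id (lmul ast a) (\<delta>s b) - tmap (dual A) (rmul prec' b) id (\<delta>s a) \<and>
      tmap (dual A) id (rmul ast b) (\<delta>s a) + tmap (dual A) (lmul succ' b) id (\<delta>s a)
        - swap (tmap (dual A) id (rmul prec' a) (\<delta>p b))
        - swap (tmap (dual A) (lmul ast a) id (\<delta>p b)) = 0)
    \<longleftrightarrow> compatible"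
  unfolding compatible_def
  by (simp add: comult_conditions_iff dual_comult_conditions_iff del: right_minus_eq cong: ball_cong) blast

end

end

section \<open>The equivalence\<close>

theorem theorem6p7:
  fixes A :: "('k::field, 'a::ab_group_add) vspace"
    and succ prec :: "'a \<Rightarrow> 'a \<Rightarrow> 'a"
    and succ' prec' :: "('a \<Rightarrow> 'k) \<Rightarrow> ('a \<Rightarrow> 'k) \<Rightarrow> ('a \<Rightarrow> 'k)"
    and \<Delta>s \<Delta>p :: "'a \<Rightarrow> ('a \<Rightarrow> 'k) \<Rightarrow> ('a \<Rightarrow> 'k) \<Rightarrow> 'k"
    and \<delta>s \<delta>p :: "('a \<Rightarrow> 'k) \<Rightarrow> (('a \<Rightarrow> 'k) \<Rightarrow> 'k) \<Rightarrow> (('a \<Rightarrow> 'k) \<Rightarrow> 'k) \<Rightarrow> 'k"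
  assumes "anti_dendriform_algebra A succ prec"
    and "anti_dendriform_algebra (dual A) succ' prec'"
    and "comult_of_dual_product A succ' \<Delta>s"
    and "comult_of_dual_product A prec' \<Delta>p"
    and "dual_comult_of_product A succ \<delta>s"
    and "dual_comult_of_product A prec \<delta>p"
  shows
    "(anti_dendriform_D_bialgebra A succ prec \<Delta>s \<Delta>p
      \<longleftrightarrow>
      (let dot = add_op succ prec; ast = add_op succ' prec'; A' = dual A in
       \<forall>x\<in>carr A. \<forall>y\<in>carr A. \<forall>a\<in>carr A'. \<forall>b\<in>carr A'.
        \<Delta>p (dot x y) = tmap A (rmul dot y) id (\<Delta>p x) - tmap A id (lmul succ x) (\<Delta>p y) \<and>
        \<Delta>s (dot x y) = tmap A id (lmul dot x) (\<Delta>s y) - tmap A (rmul prec y) id (\<Delta>s x) \<and>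
        tmap A id (rmul dot y) (\<Delta>s x) + tmap A (lmul succ y) id (\<Delta>s x)
          - swap (tmap A id (rmul prec x) (\<Delta>p y)) - swap (tmap A (lmul dot x) id (\<Delta>p y)) = 0 \<and>
        \<delta>p (ast a b) = tmap A' (rmul ast b) id (\<delta>p a) - tmap A' id (lmul succ' a) (\<delta>p b) \<and>
        \<delta>s (ast a b) = tmap A' id (lmul ast a) (\<delta>s b) - tmap A' (rmul prec' b) id (\<delta>s a) \<and>
        tmap A' id (rmul ast b) (\<delta>s a) + tmap A' (lmul succ' b) id (\<delta>s a)
          - swap (tmap A' id (rmul prec' a) (\<delta>p b)) - swap (tmap A' (lmul ast a) id (\<delta>p b)) = 0))
     \<and>
     (anti_dendriform_D_bialgebra A succ prec \<Delta>s \<Delta>p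
      \<longleftrightarrow>
      matched_pair A (add_op succ prec) (dual A) (add_op succ' prec')
        (\<lambda>x. - dual_map A (rmul prec x)) (\<lambda>x. - dual_map A (lmul succ x))
        (\<lambda>a. - predual_map A (rmul prec' a)) (\<lambda>a. - predual_map A (lmul succ' a)))"
proof -
  interpret dual_anti_dendriform_algebras A succ prec succ' prec'
    by unfold_locales fact+
  show ?thesis
    unfolding Let_def matched_pair_iff D_bialgebra_iff[OF assms(3-6)]
      comult_and_dual_comult_iff[OF assms(3-6)]
    by simp
qed

end
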